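(* Assume that $\operatorname{cf}(\mathfrak d)<\mathfrak d$. Then there are real sets $X$ and $Y$ such that $|X|<\mathfrak d$ and the set $Y$ is $\mathfrak d$-concentrated, but the product space $X\times Y$ is not Menger.
   Context: A real set is a set of real numbers with the subspace topology. $[\mathbb N]^\infty$ is the family of infinite subsets of $\mathbb N$; each $a\in[\mathbb N]^\infty$ is identified with its increasing enumeration, $a(n)$ being the $n$-th element of $a$. For $a,b\in[\mathbb N]^\infty$, $a\le^* b$ means $a(n)\le b(n)$ for all but finitely many $n$. A set $D\subseteq[\mathbb N]^\infty$ is dominating if for each $a\in[\mathbb N]^\infty$ there is $d\in D$ with $a\le^* d$; $\mathfrak d$ is the minimal cardinality of a dominating set, and $\operatorname{cf}(\mathfrak d)$ is its cofinality. For an infinite cardinal $\kappa$, a topological space $X$ with $|X|\ge\kappa$ is $\kappa$-concentrated if there is a countable set $D\subseteq X$ such that $|X\setminus U|<\kappa$ for all open sets $U\supseteq D$. A topological space $X$ is Menger if for each sequence $\mathcal U_1,\mathcal U_2,\dots$ of open covers of $X$ there are finite sets $\mathcal F_1\subseteq\mathcal U_1,\mathcal F_2\subseteq\mathcal U_2,\dots$ whose union covers $X$. *)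

theory Defs
  imports "HOL-Analysis.Analysis"
begin

unbundle cardinal_syntax

text \<open>
  Cardinals are cardinal orders in the sense of the BNF cardinal library.  The least cardinality of
  a set satisfying \<open>P\<close> is represented by the cardinal order of a chosen set of least cardinality;
  up to \<open>=o\<close> it does not depend on the choice.
\<close>

definition min_card :: "('a set \<Rightarrow> bool) \<Rightarrow> 'a rel" where
  "min_card P = |SOME A. P A \<and> (\<forall>B. P B \<longrightarrow> |A| \<le>o |B| )|"

lemma min_card_attained:
  assumes "P A\<^sub>0"
  obtains A where "P A" "min_card P = |A|" "\<And>B. P B \<Longrightarrow> |A| \<le>o |B|"
proof -
  have "\<exists>r\<in>{ |A| |A. P A}. \<forall>r'\<in>{ |A| |A. P A}. r \<le>o r'"
    by (rule exists_minim_Card_order) (use assms in \<open>auto simp: card_of_Card_order\<close>)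
  then have "\<exists>A. P A \<and> (\<forall>B. P B \<longrightarrow> |A| \<le>o |B| )"
    by blast
  from someI_ex[OF this] show ?thesis
    by (intro that[OF _ min_card_def]) simp_all
qed

lemma min_card_Card_order: "Card_order (min_card P)"
  unfolding min_card_def by (rule card_of_Card_order)

text \<open>Enumerations are indexed from 0, which does not affect the relation below.\<close>

definition le_star :: "nat set \<Rightarrow> nat set \<Rightarrow> bool" (infix \<open>\<le>\<^sup>*\<close> 50) where
  "a \<le>\<^sup>* b \<longleftrightarrow> (\<forall>\<^sub>\<infinity>n. enumerate a n \<le> enumerate b n)"

definition dominating :: "nat set set \<Rightarrow> bool" where
  "dominating D \<longleftrightarrow>
     D \<subseteq> {a. infinite a} \<and> (\<forall>a. infinite a \<longrightarrow> (\<exists>d\<in>D. a \<le>\<^sup>* d))"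

definition dominating_number :: "nat set rel" (\<open>\<dd>\<close>) where
  "\<dd> = min_card dominating"

text \<open>
  The library's \<^const>\<open>cofinal\<close> asks for strictly larger elements; in an infinite cardinal order, which
  has no largest element, this is the usual notion.
\<close>

definition cf :: "'a rel \<Rightarrow> 'a rel" where
  "cf r = min_card (\<lambda>A. A \<subseteq> Field r \<and> cofinal A r)"

definition concentrated :: "'k rel \<Rightarrow> 'a topology \<Rightarrow> bool" where
  "concentrated \<kappa> X \<longleftrightarrow>
     Cinfinite \<kappa> \<and> \<kappa> \<le>o |topspace X| \<and>
     (\<exists>D. countable D \<and> D \<subseteq> topspace X \<and>
        (\<forall>U. openin X U \<and> D \<subseteq> U \<longrightarrow> |topspace X - U| <o \<kappa>))"

definition open_cover :: "'a topology \<Rightarrow> 'a set set \<Rightarrow> bool" where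
  "open_cover X \<U> \<longleftrightarrow> (\<forall>U\<in>\<U>. openin X U) \<and> \<Union>\<U> = topspace X"

definition Menger :: "'a topology \<Rightarrow> bool" where
  "Menger X \<longleftrightarrow>
     (\<forall>\<U> :: nat \<Rightarrow> 'a set set. (\<forall>n. open_cover X (\<U> n)) \<longrightarrow>
        (\<exists>\<F>. (\<forall>n. finite (\<F> n) \<and> \<F> n \<subseteq> \<U> n) \<and> \<Union>(\<Union>n. \<F> n) = topspace X))"

lemma dominating_infinite_sets: "dominating {a. infinite a}"
  unfolding dominating_def le_star_def by auto

lemma dominating_number_attained:
  obtains D where "dominating D" "\<dd> = |D|" "\<And>E. dominating E \<Longrightarrow> |D| \<le>o |E|"
  by (rule min_card_attained[of dominating, OF dominating_infinite_sets,
        folded dominating_number_def]) (rule that)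

lemma dominating_imp_infinite:
  assumes "dominating D"
  shows "infinite D"
proof
  assume fin: "finite D"
  define f where "f n = (\<Sum>d\<in>D. enumerate d n) + Suc n" for n
  have inf: "infinite d" if "d \<in> D" for d
    using that assms unfolding dominating_def by auto
  have mono: "strict_mono f"
  proof (rule strict_monoI)
    fix m n :: nat assume "m < n"
    then have "(\<Sum>d\<in>D. enumerate d m) \<le> (\<Sum>d\<in>D. enumerate d n)"
      by (intro sum_mono) (simp add: inf)
    then show "f m < f n" using \<open>m < n\<close> unfolding f_def by linarith
  qed
  have infr: "infinite (range f)"
    using mono by (simp add: finite_image_iff strict_mono_imp_inj_on)
  have ge: "f n \<le> enumerate (range f) n" for n
  proof (induction n)
    case 0
    then show ?case
      using enumerate_in_set[OF infr, of 0] mono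
      by (auto simp: strict_mono_less_eq)
  next
    case (Suc n)
    obtain k where k: "enumerate (range f) (Suc n) = f k"
      using enumerate_in_set[OF infr, of "Suc n"] by auto
    have "f n < f k" using Suc enumerate_step[OF infr, of n] k by simp
    then have "Suc n \<le> k" using mono by (simp add: strict_mono_less)
    then show ?case using mono k by (simp add: strict_mono_less_eq)
  qed
  obtain d where d: "d \<in> D" "range f \<le>\<^sup>* d"
    using assms infr unfolding dominating_def by blast
  have "enumerate d n < enumerate (range f) n" for n
  proof -
    have "enumerate d n \<le> (\<Sum>d\<in>D. enumerate d n)"
      using fin d(1) by (intro member_le_sum) auto
    also have "\<dots> < f n" unfolding f_def by simp
    finally show ?thesis using ge[of n] by linarith
  qed
  then have "\<not> range f \<le>\<^sup>* d"
    by (simp add: le_star_def not_le[symmetric])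
  with d(2) show False by contradiction
qed

lemma dominating_number_Cinfinite: "Cinfinite \<dd>"
proof -
  obtain D where D: "dominating D" "\<dd> = |D|"
    by (rule dominating_number_attained)
  show ?thesis
    unfolding D(2) cinfinite_def Field_card_of
    using dominating_imp_infinite[OF D(1)] card_of_card_order_on by (intro conjI)
qed

lemma cf_attained:
  assumes "Cinfinite r"
  obtains A where "A \<subseteq> Field r" "cofinal A r" "cf r = |A|"
    "\<And>B. B \<subseteq> Field r \<Longrightarrow> cofinal B r \<Longrightarrow> |A| \<le>o |B|"
proof -
  have "cofinal (Field r) r"
    unfolding cofinal_def
  proof
    fix a assume a: "a \<in> Field r"
    from assms have r: "Card_order r" "infinite (Field r)"
      unfolding cinfinite_def by (rule conjunct2, rule conjunct1)
    show "\<exists>b\<in>Field r. a \<noteq> b \<and> (a, b) \<in> r"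
      by (rule infinite_Card_order_limit[OF r a])
  qed
  then have "Field r \<subseteq> Field r \<and> cofinal (Field r) r" by simp
  then show ?thesis
  proof (rule min_card_attained[of "\<lambda>A. A \<subseteq> Field r \<and> cofinal A r", folded cf_def])
    fix A
    assume "A \<subseteq> Field r \<and> cofinal A r" "cf r = |A|"
      "\<And>B. B \<subseteq> Field r \<and> cofinal B r \<Longrightarrow> |A| \<le>o |B|"
    then show ?thesis
      by (intro that[of A]) simp_all
  qed
qed

end

theory Submission
  imports Defs
begin

text \<open>
  Let \<open>D\<close> be dominating with \<open>\<dd> = |D|\<close>, and let \<open>A \<subseteq> D\<close> be cofinal in the well-order \<open>\<dd>\<close> with
  \<open>|A| < \<dd>\<close>.  For \<open>a \<in> A\<close> fewer than \<open>\<dd>\<close> functions arise from the elements of \<open>D\<close> below \<open>a\<close>, so some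
  infinite \<open>y a\<close> has, for all \<open>d\<close>, \<open>e\<close> below \<open>a\<close>, infinitely many gaps between \<open>u\<close> and \<open>e(2 d(u) + 1)\<close>.
  Let \<open>X\<close> consist of the sets \<open>y a\<close>, and \<open>Y\<close> of the finite sets together with the joins of \<open>y a\<close> and
  \<open>{d(i) | i \<in> y a}\<close> for \<open>d\<close> below \<open>a\<close>, all coded as reals by ternary expansions.

  An open set containing the finite sets contains every set with one gap that is long with respect
  to some fixed function \<open>h\<close>.  If \<open>e \<in> D\<close> dominates \<open>h\<close>, it therefore contains every join whose \<open>a\<close>
  is above \<open>e\<close>, and there are fewer than \<open>\<dd>\<close> other ones: \<open>Y\<close> is concentrated on the finite sets.

  The pairs in \<open>X \<times> Y\<close> whose first component is the even part of the second form a closed set that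
  avoids the finite sets, as all \<open>y a\<close> are infinite.  On it the odd part is infinite, depends
  continuously on the pair, and ranges over a dominating family, so \<open>X \<times> Y\<close> is not Menger.
\<close>

section \<open>Enumerations and undominated sets\<close>

text \<open>The product embeds in the square of the larger factor; that square is finite, or
  equinumerous with the factor.\<close>

lemma card_of_Times_ordLess_Cinfinite:
  assumes r: "Cinfinite r" and "|A| <o r" "|B| <o r"
  shows "|A \<times> B| <o r"
proof -
  have square: "|C \<times> C| <o r" if C: "|C| <o r" for C
  proof (cases "finite C")
    case True
    then have "Cfinite |C \<times> C|"
      by (simp add: cfinite_def Field_card_of card_of_card_order_on)
    then show ?thesis using r by (rule Cfinite_ordLess_Cinfinite)
  next
    case False
    from card_of_Times_same_infinite[OF this] C show ?thesis
      by (rule ordIso_ordLess_trans)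
  qed
  have "|A| \<le>o |B| \<or> |B| \<le>o |A|"
    by (rule ordLeq_total) (rule card_of_Well_order)+
  then show ?thesis
  proof
    assume "|A| \<le>o |B|"
    then show ?thesis
      by (rule ordLeq_ordLess_trans[OF card_of_Times_mono1 square[OF assms(3)]])
  next
    assume "|B| \<le>o |A|"
    then show ?thesis
      by (rule ordLeq_ordLess_trans[OF card_of_Times_mono2 square[OF assms(2)]])
  qed
qed

text \<open>The elements below \<open>k\<close> are an initial piece of the enumeration. The count
  depends on finitely many memberships only, which later makes such bounds open conditions.\<close>

lemma enumerate_less_iff_card:
  fixes S :: "nat set"
  assumes "infinite S"
  shows "enumerate S n < k \<longleftrightarrow> n < card {i\<in>S. i < k}"
proof
  assume "enumerate S n < k"
  then have "enumerate S ` {..n} \<subseteq> {i\<in>S. i < k}"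
    using assms by (auto simp: enumerate_in_set intro: le_less_trans[of _ "enumerate S n"])
  then have "card (enumerate S ` {..n}) \<le> card {i\<in>S. i < k}"
    by (intro card_mono) auto
  moreover have "card (enumerate S ` {..n}) = Suc n"
    by (subst card_image) (use inj_enumerate[OF assms] in \<open>auto intro: inj_on_subset\<close>)
  ultimately show "n < card {i\<in>S. i < k}" by simp
next
  assume n: "n < card {i\<in>S. i < k}"
  show "enumerate S n < k"
  proof (rule ccontr)
    assume "\<not> enumerate S n < k"
    have "{i\<in>S. i < k} \<subseteq> enumerate S ` {..<n}"
    proof clarify
      fix i assume "i \<in> S" "i < k"
      moreover obtain m where "i = enumerate S m"
        using enumerate_Ex[OF assms \<open>i \<in> S\<close>] by metis
      ultimately have "enumerate S m < enumerate S n"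
        using \<open>\<not> enumerate S n < k\<close> by simp
      then have "m < n" using assms by simp
      with \<open>i = enumerate S m\<close> show "i \<in> enumerate S ` {..<n}" by simp
    qed
    then have "card {i\<in>S. i < k} \<le> card {..<n}"
      by (rule surj_card_le[rotated]) simp
    with n show False by simp
  qed
qed

text \<open>A subset has no more elements below any bound, so thinning out a set preserves
  domination.\<close>

lemma enumerate_antimono:
  fixes S :: "nat set"
  assumes "infinite S" "S \<subseteq> T"
  shows "enumerate T n \<le> enumerate S n"
proof (rule ccontr)
  assume less: "\<not> enumerate T n \<le> enumerate S n"
  have T: "infinite T" using assms infinite_super by blast
  have "n < card {i\<in>S. i < enumerate T n}"
    using less by (simp add: enumerate_less_iff_card[OF assms(1), symmetric])
  also have "\<dots> \<le> card {i\<in>T. i < enumerate T n}"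
    using assms by (intro card_mono) auto
  finally show False using enumerate_less_iff_card[OF T, of n "enumerate T n"] by simp
qed

lemma infinite_set_above:
  fixes f :: "nat \<Rightarrow> nat"
  obtains S where "infinite S" "\<And>n. f n \<le> enumerate S n"
proof -
  \<comment> \<open>The successors make \<open>F\<close> strictly increasing, and the last summand
    alone gives \<open>f n \<le> F n\<close>.\<close>
  define F where "F n = (\<Sum>i\<le>n. Suc (f i))" for n
  have "strict_mono F"
    unfolding strict_mono_Suc_iff F_def by simp
  then have inf: "infinite (range F)"
    by (simp add: finite_image_iff strict_mono_imp_inj_on)
  have "f n \<le> enumerate (range F) n" for n
  proof (rule ccontr)
    assume less: "\<not> f n \<le> enumerate (range F) n"
    have "{i\<in>range F. i < f n} \<subseteq> F ` {..<n}"
    proof clarify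
      fix m assume "F m < f n"
      moreover have "f n \<le> F n" unfolding F_def
        by (rule order_trans[OF _ member_le_sum[of n]]) auto
      ultimately have "m < n"
        using strict_mono_less[OF \<open>strict_mono F\<close>, of m n] by linarith
      then show "F m \<in> F ` {..<n}" by simp
    qed
    then have "card {i\<in>range F. i < f n} \<le> card {..<n}"
      by (rule surj_card_le[rotated]) simp
    with less show False by (simp add: enumerate_less_iff_card[OF inf] not_le)
  qed
  with inf show ?thesis by (rule that)
qed

text \<open>Replacing each function by an infinite set enumerated above it yields fewer than
  \<open>\<dd>\<close> sets; these cannot be dominating, and \<open>x\<close> witnesses the
  failure.\<close>

lemma ex_undominated:
  fixes F :: "(nat \<Rightarrow> nat) set"
  assumes "|F| <o \<dd>"
  obtains x where "infinite x" "\<And>f. f \<in> F \<Longrightarrow> \<exists>\<^sub>\<infinity>n. f n < enumerate x n"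
proof -
  have "\<forall>f :: nat \<Rightarrow> nat. \<exists>S. infinite S \<and> (\<forall>n. f n \<le> enumerate S n)"
  proof
    show "\<exists>S. infinite S \<and> (\<forall>n. f n \<le> enumerate S n)" for f :: "nat \<Rightarrow> nat"
      by (rule infinite_set_above[of f]) blast
  qed
  then have "\<exists>s. \<forall>f :: nat \<Rightarrow> nat. infinite (s f) \<and> (\<forall>n. f n \<le> enumerate (s f) n)"
    by (rule choice)
  then obtain s :: "(nat \<Rightarrow> nat) \<Rightarrow> nat set" where s: "\<And>f. infinite (s f)" "\<And>f n. f n \<le> enumerate (s f) n"
    by blast
  obtain D where D: "\<dd> = |D|" "\<And>E. dominating E \<Longrightarrow> |D| \<le>o |E|"
    by (rule dominating_number_attained) blast
  have "|s ` F| <o \<dd>"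
    using card_of_image assms by (rule ordLeq_ordLess_trans)
  then have "\<not> dominating (s ` F)"
    using D not_ordLess_ordLeq by metis
  with s(1) obtain x where x: "infinite x" "\<And>f. f \<in> F \<Longrightarrow> \<not> x \<le>\<^sup>* s f"
    unfolding dominating_def by auto
  have "\<exists>\<^sub>\<infinity>n. f n < enumerate x n" if "f \<in> F" for f
  proof -
    have "\<exists>\<^sub>\<infinity>n. enumerate (s f) n < enumerate x n"
      using x(2)[OF that] by (simp add: le_star_def not_le)
    then show ?thesis
      by (rule frequently_elim1) (use s(2) le_less_trans in blast)
  qed
  with x(1) show ?thesis by (rule that)
qed

lemma ex_set_with_gaps:
  fixes F :: "(nat \<Rightarrow> nat) set"
  assumes "|F| <o \<dd>" and mono: "\<And>f. f \<in> F \<Longrightarrow> mono f"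
  shows "\<exists>y. infinite y \<and> (\<forall>f\<in>F. \<exists>\<^sub>\<infinity>u. y \<inter> {u..<f u} = {})"
proof -
  \<comment> \<open>If \<open>y\<close> meets \<open>{u..<f u}\<close> for all \<open>u \<ge> m\<close>, then following the \<open>f\<close>-orbit of \<open>m\<close> bounds the
    \<open>n\<close>-th element of \<open>y\<close> by \<open>(f ^^ Suc n) m\<close>, hence by \<open>(f ^^ Suc n) n\<close> for large \<open>n\<close>.\<close>
  define it where "it f n = (f ^^ Suc n) n" for f :: "nat \<Rightarrow> nat" and n
  have "|it ` F| <o \<dd>"
    using card_of_image assms(1) by (rule ordLeq_ordLess_trans)
  then obtain y where y: "infinite y" "\<And>f. f \<in> F \<Longrightarrow> \<exists>\<^sub>\<infinity>n. it f n < enumerate y n"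
    by (rule ex_undominated) blast
  have "\<exists>\<^sub>\<infinity>u. y \<inter> {u..<f u} = {}" if f: "f \<in> F" for f
  proof (rule ccontr)
    assume "\<not> ?thesis"
    then obtain m where m: "\<And>u. u \<ge> m \<Longrightarrow> y \<inter> {u..<f u} \<noteq> {}"
      by (auto simp: INFM_nat_le)
    have orbit: "m \<le> (f ^^ k) m \<and> k \<le> card {i\<in>y. i < (f ^^ k) m}" for k
    proof (induction k)
      case (Suc k)
      let ?v = "(f ^^ k) m"
      obtain j where j: "j \<in> y" "?v \<le> j" "j < f ?v"
        using m Suc by fastforce
      have "Suc k \<le> card (insert j {i\<in>y. i < ?v})"
        using Suc j by simp
      also have "\<dots> \<le> card {i\<in>y. i < f ?v}"
        using j by (intro card_mono) auto
      finally show ?case using Suc j by simp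
    qed simp
    have "enumerate y n < it f n" if "n \<ge> m" for n
    proof -
      have "enumerate y n < (f ^^ Suc n) m"
        using orbit[of "Suc n"] enumerate_less_iff_card[OF y(1)] by simp
      also have "\<dots> \<le> it f n"
        unfolding it_def by (rule monoD[OF mono_pow[OF mono[OF f]] that])
      finally show ?thesis .
    qed
    with y(2)[OF f] show False
      by (auto simp: INFM_nat_le) (meson order_less_asym)
  qed
  with y(1) show ?thesis by blast
qed

section \<open>Sets of naturals as reals\<close>

text \<open>Base 3 with digits 0 and 1 keeps expansions unique; the range is the Cantor set scaled
  by 3/2.\<close>

definition ternary :: "nat set \<Rightarrow> real" where
  "ternary S = (\<Sum>i. if i \<in> S then (1/3)^i else 0)"

lemma summable_ternary: "summable (\<lambda>i. if i \<in> S then (1/3::real)^i else 0)"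
  by (rule summable_comparison_test'[OF summable_geometric[of "1/3"]]) auto

lemma ternary_split:
  "ternary S = (\<Sum>i<n. if i \<in> S then (1/3)^i else 0) + (\<Sum>i. if i + n \<in> S then (1/3)^(i+n) else 0)"
  unfolding ternary_def suminf_split_initial_segment[OF summable_ternary, of S n]
  by (rule add.commute)

lemma ternary_tail_bounds:
  "0 \<le> (\<Sum>i. if i + n \<in> S then (1/3::real)^(i+n) else 0)"
  "(\<Sum>i. if i + n \<in> S then (1/3::real)^(i+n) else 0) \<le> (3/2) * (1/3)^n"
proof -
  have sm: "summable (\<lambda>i. if i + n \<in> S then (1/3::real)^(i+n) else 0)"
    using summable_ignore_initial_segment[OF summable_ternary] .
  show "0 \<le> (\<Sum>i. if i + n \<in> S then (1/3::real)^(i+n) else 0)"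
    by (rule suminf_nonneg[OF sm]) simp
  have "(\<lambda>i. (1/3::real)^n * (1/3)^i) sums ((1/3)^n * (1 / (1 - 1/3)))"
    by (intro sums_mult geometric_sums) simp
  then have g: "(\<lambda>i. (1/3::real)^(i+n)) sums ((3/2) * (1/3)^n)"
    by (simp add: power_add mult.commute)
  show "(\<Sum>i. if i + n \<in> S then (1/3::real)^(i+n) else 0) \<le> (3/2) * (1/3)^n"
    unfolding sums_unique[OF g]
    by (rule suminf_le[OF _ sm sums_summable[OF g]]) simp
qed

lemma ternary_close:
  assumes "S \<inter> {..<n} = T \<inter> {..<n}"
  shows "\<bar>ternary S - ternary T\<bar> \<le> (3/2) * (1/3)^n"
proof -
  have "(\<Sum>i<n. if i \<in> S then (1/3::real)^i else 0) = (\<Sum>i<n. if i \<in> T then (1/3)^i else 0)"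
    using assms by (intro sum.cong) auto
  then show ?thesis
    using ternary_tail_bounds[of n S] ternary_tail_bounds[of n T]
      ternary_split[of S n] ternary_split[of T n] by linarith
qed

text \<open>The digit at \<open>n\<close> contributes \<open>(1/3)^n\<close>, while all later digits
  of \<open>T\<close> together contribute at most half of that.\<close>

lemma ternary_far:
  assumes "S \<inter> {..<n} = T \<inter> {..<n}" "n \<in> S" "n \<notin> T"
  shows "ternary S - ternary T \<ge> (1/3)^n / 2"
proof -
  have "(\<Sum>i<n. if i \<in> S then (1/3::real)^i else 0) = (\<Sum>i<n. if i \<in> T then (1/3)^i else 0)"
    using assms(1) by (intro sum.cong) auto
  then show ?thesis
    using ternary_tail_bounds(1)[of "Suc n" S] ternary_tail_bounds(2)[of "Suc n" T] assms(2,3)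
      ternary_split[of S "Suc n"] ternary_split[of T "Suc n"]
    by simp
qed

text \<open>Decoding is continuous: \<open>ternary_far\<close> applies at the first disagreement
  \<open>j\<close>.\<close>

lemma ternary_near_imp_agree:
  assumes "\<bar>ternary S - ternary T\<bar> < (1/3)^n / 2" "i \<le> n"
  shows "i \<in> S \<longleftrightarrow> i \<in> T"
proof (rule ccontr)
  define j where "j = (LEAST i. (i \<in> S) \<noteq> (i \<in> T))"
  assume i: "\<not> (i \<in> S \<longleftrightarrow> i \<in> T)"
  have j: "(j \<in> S) \<noteq> (j \<in> T)"
    unfolding j_def by (rule LeastI[of "\<lambda>i. (i \<in> S) \<noteq> (i \<in> T)"]) (use i in blast)
  have "j \<le> i"
    unfolding j_def by (rule Least_le) (use i in blast)
  have agree: "S \<inter> {..<j} = T \<inter> {..<j}"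
    using not_less_Least[of _ "\<lambda>i. (i \<in> S) \<noteq> (i \<in> T)", folded j_def] by blast
  have "(1/3)^j / 2 \<le> \<bar>ternary S - ternary T\<bar>"
    using j ternary_far[OF agree] ternary_far[OF agree[symmetric]] by (smt (verit))
  moreover have "(1/3::real)^n \<le> (1/3)^j"
    using \<open>j \<le> i\<close> assms(2) by (intro power_decreasing) auto
  ultimately show False using assms(1) by linarith
qed

lemma inj_ternary: "inj ternary"
proof (rule injI, rule set_eqI)
  fix S T i assume "ternary S = ternary T"
  then show "i \<in> S \<longleftrightarrow> i \<in> T"
    by (intro ternary_near_imp_agree[of _ _ i]) auto
qed

text \<open>Sufficiently close pairs agree on the first digits in both coordinates, so a property
  secured by finitely many digits is open.\<close>

lemma openin_ternary_Times:
  assumes local: "\<And>S T. P S T \<Longrightarrow> \<exists>n. \<forall>S' T'. (\<forall>i\<le>n. (i \<in> S') = (i \<in> S) \<and> (i \<in> T') = (i \<in> T)) \<longrightarrow> P S' T'"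
  shows "openin (top_of_set (ternary ` \<X> \<times> ternary ` \<Y>))
    {(ternary S, ternary T) |S T. S \<in> \<X> \<and> T \<in> \<Y> \<and> P S T}"
  unfolding openin_euclidean_subtopology_iff
proof (intro conjI ballI)
  show "{(ternary S, ternary T) |S T. S \<in> \<X> \<and> T \<in> \<Y> \<and> P S T} \<subseteq> ternary ` \<X> \<times> ternary ` \<Y>"
    by auto
next
  fix p assume "p \<in> {(ternary S, ternary T) |S T. S \<in> \<X> \<and> T \<in> \<Y> \<and> P S T}"
  then obtain S T where p: "p = (ternary S, ternary T)" "P S T" by blast
  from local[OF p(2)] obtain n
    where n: "\<And>S' T'. (\<forall>i\<le>n. (i \<in> S') = (i \<in> S) \<and> (i \<in> T') = (i \<in> T)) \<Longrightarrow> P S' T'"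
    by blast
  have "q \<in> {(ternary S, ternary T) |S T. S \<in> \<X> \<and> T \<in> \<Y> \<and> P S T}"
    if q: "q \<in> ternary ` \<X> \<times> ternary ` \<Y>" "dist q p < (1/3)^n / 2" for q
  proof -
    obtain S' T' where q': "q = (ternary S', ternary T')" "S' \<in> \<X>" "T' \<in> \<Y>"
      using q(1) by blast
    have "\<bar>ternary S' - ternary S\<bar> < (1/3)^n / 2" "\<bar>ternary T' - ternary T\<bar> < (1/3)^n / 2"
      using q(2) dist_fst_le[of q p] dist_snd_le[of q p] by (auto simp: p(1) q'(1) dist_real_def)
    then have "P S' T'"
      by (intro n) (blast dest: ternary_near_imp_agree)
    with q' show ?thesis by blast
  qed
  then show "\<exists>e>0. \<forall>q\<in>ternary ` \<X> \<times> ternary ` \<Y>. dist q p < e \<longrightarrow>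
      q \<in> {(ternary S, ternary T) |S T. S \<in> \<X> \<and> T \<in> \<Y> \<and> P S T}"
    by (intro exI[of _ "(1/3)^n / 2"]) auto
qed

lemma openin_ternary_finite_gap:
  assumes U: "openin (top_of_set (ternary ` \<Y>)) U" "ternary ` Collect finite \<subseteq> U"
  obtains h :: "nat \<Rightarrow> nat"
  where "\<And>S u. S \<in> \<Y> \<Longrightarrow> S \<inter> {..<h u} \<subseteq> {..<u} \<Longrightarrow> ternary S \<in> U"
proof -
  have "\<exists>n. \<forall>S\<in>\<Y>. S \<inter> {..<n} = F \<inter> {..<n} \<longrightarrow> ternary S \<in> U" if "finite F" for F
  proof -
    have "ternary F \<in> U" using U(2) that by blast
    with U(1) have "\<exists>e>0. \<forall>r\<in>ternary ` \<Y>. dist r (ternary F) < e \<longrightarrow> r \<in> U"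
      unfolding openin_euclidean_subtopology_iff by simp
    then obtain e where e: "e > 0" "\<And>r. r \<in> ternary ` \<Y> \<Longrightarrow> dist r (ternary F) < e \<Longrightarrow> r \<in> U"
      by blast
    obtain n where n: "(1/3::real)^n < e / 2"
      using real_arch_pow_inv[of "e/2" "1/3"] e(1) by auto
    have "ternary S \<in> U" if "S \<in> \<Y>" "S \<inter> {..<n} = F \<inter> {..<n}" for S
      using ternary_close[OF that(2)] n e(1) that(1) by (intro e(2)) (auto simp: dist_real_def)
    then show ?thesis by blast
  qed
  then obtain g where g: "\<And>F S. finite F \<Longrightarrow> S \<in> \<Y> \<Longrightarrow> S \<inter> {..<g F} = F \<inter> {..<g F} \<Longrightarrow> ternary S \<in> U"
    by metis
  \<comment> \<open>Only finitely many traces on \<open>{..<u}\<close> exist, so one number exceeds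
    the radius index \<open>g\<close> of each. A set with a gap from \<open>u\<close> to
    \<open>h u\<close> is then close enough to its own finite trace.\<close>
  define h where "h u = (\<Sum>F\<in>Pow {..<u}. g F)" for u :: nat
  have "ternary S \<in> U" if S: "S \<in> \<Y>" "S \<inter> {..<h u} \<subseteq> {..<u}" for S u
  proof (rule g[of "S \<inter> {..<u}"])
    have "g (S \<inter> {..<u}) \<le> h u"
      unfolding h_def by (rule member_le_sum) auto
    then show "S \<inter> {..<g (S \<inter> {..<u})} = S \<inter> {..<u} \<inter> {..<g (S \<inter> {..<u})}"
      using S(2) by fastforce
  qed (use S in auto)
  then show ?thesis by (rule that)
qed

section \<open>Menger spaces\<close>

text \<open>Finitely many members of an increasing cover lie in a single one, so the selection
  reduces to one index per cover.\<close>

lemma Menger_increasing: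
  fixes V :: "nat \<Rightarrow> nat \<Rightarrow> 'a set"
  assumes "Menger X" and "\<And>n k. openin X (V n k)" and mono: "\<And>n. mono (V n)"
    and cov: "\<And>n p. p \<in> topspace X \<Longrightarrow> \<exists>k. p \<in> V n k"
  obtains k where "\<And>p. p \<in> topspace X \<Longrightarrow> \<exists>n. p \<in> V n (k n)"
proof -
  have "open_cover X (range (V n))" for n
    unfolding open_cover_def
  proof (intro conjI equalityI ballI subsetI)
    show "openin X U" if "U \<in> range (V n)" for U
      using that assms(2) by auto
    show "p \<in> topspace X" if "p \<in> \<Union>(range (V n))" for p
      using that openin_subset[OF assms(2)[of n]] by blast
    show "p \<in> \<Union>(range (V n))" if "p \<in> topspace X" for p
      using cov[OF that] by blast
  qed
  then have "\<exists>\<F>. (\<forall>n. finite (\<F> n) \<and> \<F> n \<subseteq> range (V n)) \<and> \<Union>(\<Union>n. \<F> n) = topspace X"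
    using assms(1)[unfolded Menger_def, rule_format, of "\<lambda>n. range (V n)"] by simp
  then obtain \<F> where fin_cov:
    "(\<forall>n. finite (\<F> n) \<and> \<F> n \<subseteq> range (V n)) \<and> \<Union>(\<Union>n. \<F> n) = topspace X" ..
  have "\<exists>k. \<Union>(\<F> n) \<subseteq> V n k" for n
  proof -
    obtain K where K: "finite K" "\<F> n = V n ` K"
      using finite_subset_image[of "\<F> n" "V n" UNIV] fin_cov by auto
    \<comment> \<open>If \<open>K\<close> is empty, so is the union, and the unspecified value of
      \<open>Max K\<close> is harmless.\<close>
    have "V n k \<subseteq> V n (Max K)" if "k \<in> K" for k
      using Max_ge[OF K(1) that] by (rule monoD[OF mono])
    then have "\<Union>(\<F> n) \<subseteq> V n (Max K)" unfolding K(2) by (rule UN_least)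
    then show ?thesis ..
  qed
  then obtain k where k: "\<And>n. \<Union>(\<F> n) \<subseteq> V n (k n)" by metis
  show ?thesis
  proof (rule that[of k])
    fix p assume "p \<in> topspace X"
    then have "p \<in> \<Union>(\<Union>n. \<F> n)" using fin_cov by simp
    then obtain n where "p \<in> \<Union>(\<F> n)" by blast
    with k show "\<exists>n. p \<in> V n (k n)" by blast
  qed
qed

text \<open>The selection is made for every tail of the sequence of covers, and the resulting index
  functions are merged into one.\<close>

lemma Menger_increasing_INFM:
  fixes V :: "nat \<Rightarrow> nat \<Rightarrow> 'a set"
  assumes "Menger X" and "\<And>n k. openin X (V n k)" and mono: "\<And>n. mono (V n)"
    and "\<And>n p. p \<in> topspace X \<Longrightarrow> \<exists>k. p \<in> V n k"
  shows "\<exists>k. \<forall>p\<in>topspace X. \<exists>\<^sub>\<infinity>n. p \<in> V n (k n)"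
proof -
  have "\<exists>k. \<forall>p\<in>topspace X. \<exists>n. p \<in> V (n + m) (k n)" for m
    using Menger_increasing[of X "\<lambda>n. V (n + m)"] assms by metis
  then obtain k where k: "\<And>m p. p \<in> topspace X \<Longrightarrow> \<exists>n. p \<in> V (n + m) (k m n)"
    by metis
  \<comment> \<open>Position \<open>n\<close> of the sequence is position \<open>n - m\<close> of
    the tail starting at \<open>m\<close>.\<close>
  define K where "K n = (\<Sum>m\<le>n. k m (n - m))" for n
  have "\<exists>n\<ge>m. p \<in> V n (K n)" if p: "p \<in> topspace X" for p m
  proof -
    obtain n where n: "p \<in> V (n + m) (k m n)" using k p by blast
    have "k m (n + m - m) \<le> K (n + m)"
      unfolding K_def by (rule member_le_sum) auto
    then have "p \<in> V (n + m) (K (n + m))"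
      using monoD[OF mono] n by (metis add_diff_cancel_right' subsetD)
    then show ?thesis using le_add2 by blast
  qed
  then show ?thesis by (intro exI[of _ K]) (simp add: INFM_nat_le)
qed

section \<open>Joins and the main theorem\<close>

definition join :: "nat set \<Rightarrow> nat set \<Rightarrow> nat set" where
  "join y z = (\<lambda>i. 2 * i) ` y \<union> (\<lambda>i. Suc (2 * i)) ` z"

lemma even_in_join [simp]: "2 * i \<in> join y z \<longleftrightarrow> i \<in> y"
  unfolding join_def by (auto simp: image_iff) presburger

lemma odd_in_join [simp]: "Suc (2 * i) \<in> join y z \<longleftrightarrow> i \<in> z"
  unfolding join_def by (auto simp: image_iff) presburger

text \<open>Each element of the join comes from some \<open>i \<in> y\<close> not exceeding it.
  Below \<open>v\<close> this forces \<open>i < v\<close>, and the gap then forces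
  \<open>i < u\<close>.\<close>

lemma join_enumerate_gap:
  assumes "infinite d" "y \<inter> {u..<v} = {}"
  shows "join y (enumerate d ` y) \<inter> {..<v} \<subseteq> {..<Suc (2 * enumerate d u)}"
proof
  fix j assume j: "j \<in> join y (enumerate d ` y) \<inter> {..<v}"
  then obtain i where i: "i \<in> y" "j = 2 * i \<or> j = Suc (2 * enumerate d i)"
    by (auto simp: join_def)
  have "i \<le> enumerate d i" using assms(1) by (rule le_enumerate)
  with i j have "i < v" by auto
  with i(1) assms(2) have "i < u" by fastforce
  moreover from this have "enumerate d i < enumerate d u" by (simp add: assms(1))
  moreover have "u \<le> enumerate d u" using assms(1) by (rule le_enumerate)
  ultimately show "j \<in> {..<Suc (2 * enumerate d u)}" using i(2) by auto
qed

theorem theorem2p10: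
  assumes "cf \<dd> <o \<dd>"
  shows "\<exists>(X :: real set) (Y :: real set).
           |X| <o \<dd> \<and>
           concentrated \<dd> (top_of_set Y) \<and>
           \<not> Menger (prod_topology (top_of_set X) (top_of_set Y))"
proof -

  \<comment> \<open>Cofinal indices and sets with gaps\<close>
  obtain D where D: "dominating D" "\<dd> = |D|" "\<And>E. dominating E \<Longrightarrow> |D| \<le>o |E|"
    by (rule dominating_number_attained) blast
  have Dinf: "infinite d" if "d \<in> D" for d
    using D(1) that unfolding dominating_def by blast
  have field: "Field \<dd> = D" and card: "Card_order \<dd>"
    unfolding D(2) by (rule Field_card_of, rule card_of_Card_order)
  \<comment> \<open>Cofinality refers to the well-order \<open>\<dd>\<close> on \<open>D\<close>,
    not to domination; elements of \<open>A\<close> serve only as indices.\<close>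
  obtain A where A: "A \<subseteq> D" "cofinal A \<dd>" "cf \<dd> = |A|"
    by (rule cf_attained[OF dominating_number_Cinfinite, unfolded field])
  have dom_fun: "\<exists>d\<in>D. \<forall>\<^sub>\<infinity>n. f n \<le> enumerate d n" for f
  proof -
    obtain S where S: "infinite S" "\<And>n. f n \<le> enumerate S n" by (rule infinite_set_above[of f]) blast
    then obtain d where "d \<in> D" "\<forall>\<^sub>\<infinity>n. enumerate S n \<le> enumerate d n"
      using D(1) unfolding dominating_def le_star_def by blast
    moreover from this(2) have "\<forall>\<^sub>\<infinity>n. f n \<le> enumerate d n"
      by (rule eventually_mono) (use S(2) order_trans in blast)
    ultimately show ?thesis by blast
  qed
  have above: "\<exists>a\<in>A. d \<in> underS \<dd> a" if "d \<in> D" for d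
    using A(2) that unfolding cofinal_def field underS_def by blast
  have below_inf: "infinite d" if "d \<in> underS \<dd> a" for a d
    using that field by (intro Dinf) (auto simp: underS_def Field_def)

  \<comment> \<open>By \<open>join_enumerate_gap\<close>, a gap of \<open>y\<close> from
    \<open>u\<close> to \<open>G (d, e) u\<close> becomes a gap of the join from
    \<open>m = Suc (2 * enumerate d u)\<close> to \<open>enumerate e m\<close>.\<close>
  define G where "G = (\<lambda>(d :: nat set, e :: nat set) u. enumerate e (Suc (2 * enumerate d u)))"
  have "\<exists>y. infinite y \<and> (\<forall>d\<in>underS \<dd> a. \<forall>e\<in>underS \<dd> a. \<exists>\<^sub>\<infinity>u. y \<inter> {u..<G (d, e) u} = {})"
    if a: "a \<in> A" for a
  proof -
    have "|underS \<dd> a| <o \<dd>"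
      using card A(1) a field by (intro card_of_underS) auto
    with dominating_number_Cinfinite this have "|underS \<dd> a \<times> underS \<dd> a| <o \<dd>"
      by (rule card_of_Times_ordLess_Cinfinite)
    with card_of_image have "|G ` (underS \<dd> a \<times> underS \<dd> a)| <o \<dd>"
      by (rule ordLeq_ordLess_trans)
    moreover have "mono f" if "f \<in> G ` (underS \<dd> a \<times> underS \<dd> a)" for f
      using that by (auto simp: G_def mono_def below_inf)
    ultimately have "\<exists>y. infinite y \<and>
        (\<forall>f\<in>G ` (underS \<dd> a \<times> underS \<dd> a). \<exists>\<^sub>\<infinity>u. y \<inter> {u..<f u} = {})"
      by (rule ex_set_with_gaps)
    then show ?thesis by simp
  qed
  then obtain y where y: "\<And>a. a \<in> A \<Longrightarrow> infinite (y a)"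
    and gaps: "\<And>a d e. a \<in> A \<Longrightarrow> d \<in> underS \<dd> a \<Longrightarrow> e \<in> underS \<dd> a \<Longrightarrow>
        \<exists>\<^sub>\<infinity>u. y a \<inter> {u..<G (d, e) u} = {}"
    by metis

  define t where "t = (\<lambda>(a, d). join (y a) (enumerate d ` y a))"
  define \<X> where "\<X> = y ` A"
  define \<T> where "\<T> = t ` (SIGMA a:A. underS \<dd> a)"
  define \<Y> where "\<Y> = Collect finite \<union> \<T>"
  have odd_inf: "infinite (enumerate d ` y a)" if "a \<in> A" "d \<in> underS \<dd> a" for a d
    using y[OF that(1)] inj_on_subset[OF inj_enumerate[OF below_inf[OF that(2)]] subset_UNIV]
    by (simp add: finite_image_iff)
  have odd_sub: "enumerate d ` y a \<subseteq> d" if "d \<in> underS \<dd> a" for a d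
    using enumerate_in_set[OF below_inf[OF that]] by blast

  \<comment> \<open>Cardinalities of the two real sets\<close>
  have "|ternary ` \<X>| <o \<dd>"
  proof -
    have "|ternary ` \<X>| \<le>o |A|"
      unfolding \<X>_def image_image by (rule card_of_image)
    then show ?thesis using assms A(3) ordLeq_ordLess_trans by metis
  qed

  moreover have "\<dd> \<le>o |ternary ` \<Y>|"
  proof -
    \<comment> \<open>The odd parts of the joins can be decoded from \<open>\<Y>\<close>. They
      dominate because each is an infinite subset of its \<open>d\<close> and every
      \<open>d \<in> D\<close> occurs.\<close>
    define E :: "nat set set" where "E = (\<lambda>(a, d). enumerate d ` y a) ` (SIGMA a:A. underS \<dd> a)"
    have "dominating E"
      unfolding dominating_def
    proof (intro conjI allI impI)
      show "E \<subseteq> {a. infinite a}" using odd_inf by (auto simp: E_def)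
      fix b :: "nat set" assume "infinite b"
      then obtain d where d: "d \<in> D" "b \<le>\<^sup>* d" using D(1) unfolding dominating_def by blast
      obtain a where a: "a \<in> A" "d \<in> underS \<dd> a" using above d by blast
      have "b \<le>\<^sup>* enumerate d ` y a"
        using d(2) unfolding le_star_def
        by (rule eventually_mono)
          (use enumerate_antimono[OF odd_inf[OF a] odd_sub[OF a(2)]] order_trans in blast)
      with a show "\<exists>d\<in>E. b \<le>\<^sup>* d" by (force simp: E_def)
    qed
    then have "\<dd> \<le>o |E|" using D by simp
    also have "|E| \<le>o |ternary ` \<Y>|"
    proof (rule surj_imp_ordLeq)
      show "E \<subseteq> (\<lambda>r. {i. Suc (2 * i) \<in> inv ternary r}) ` ternary ` \<Y>"
      proof
        fix z assume "z \<in> E"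
        then obtain a d where ad: "(a, d) \<in> (SIGMA a:A. underS \<dd> a)" "z = enumerate d ` y a"
          by (auto simp: E_def)
        then have "z = {i. Suc (2 * i) \<in> inv ternary (ternary (t (a, d)))}"
          by (simp add: inv_f_f[OF inj_ternary] t_def)
        moreover have "t (a, d) \<in> \<Y>" using ad by (auto simp: \<Y>_def \<T>_def)
        ultimately show "z \<in> (\<lambda>r. {i. Suc (2 * i) \<in> inv ternary r}) ` ternary ` \<Y>" by blast
      qed
    qed
    finally show ?thesis .
  qed

  \<comment> \<open>Concentration on the finite sets\<close>
  moreover have "|ternary ` \<Y> - U| <o \<dd>"
    if U: "openin (top_of_set (ternary ` \<Y>)) U" "ternary ` Collect finite \<subseteq> U" for U
  proof -
    obtain h where h: "\<And>S u. S \<in> \<Y> \<Longrightarrow> S \<inter> {..<h u} \<subseteq> {..<u} \<Longrightarrow> ternary S \<in> U"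
      using openin_ternary_finite_gap[OF U] by metis
    obtain e where e: "e \<in> D" "\<forall>\<^sub>\<infinity>n. h n \<le> enumerate e n" using dom_fun by blast
    then obtain n0 where n0: "\<And>n. n \<ge> n0 \<Longrightarrow> h n \<le> enumerate e n"
      by (auto simp: MOST_nat_le)
    obtain b where b: "b \<in> A" "e \<in> underS \<dd> b" using above e(1) by blast
    have in_U: "ternary (t (a, d)) \<in> U"
      if ad: "a \<in> A" "d \<in> underS \<dd> a" "e \<in> underS \<dd> a" for a d
    proof -
      have d: "infinite d" using ad(2) by (rule below_inf)
      obtain u where u: "u \<ge> n0" "y a \<inter> {u..<G (d, e) u} = {}"
        using gaps[OF ad] by (auto simp: INFM_nat_le)
      let ?m = "Suc (2 * enumerate d u)"
      \<comment> \<open>The gap is chosen beyond \<open>n0\<close> so that \<open>e\<close> bounds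
        \<open>h\<close> at the point \<open>?m\<close> where the gap of the join begins.\<close>
      have "n0 \<le> ?m" using u(1) le_enumerate[OF d, of u] by simp
      then have "h ?m \<le> G (d, e) u" using n0 by (simp add: G_def)
      then have "t (a, d) \<inter> {..<h ?m} \<subseteq> {..<?m}"
        using join_enumerate_gap[OF d u(2)] by (fastforce simp: t_def)
      moreover have "t (a, d) \<in> \<Y>" using ad by (auto simp: \<Y>_def \<T>_def)
      ultimately show ?thesis by (intro h)
    qed
    have wo: "wo_rel \<dd>" using card by (simp add: wo_rel_def card_order_on_def)
    \<comment> \<open>For a join outside \<open>U\<close>, \<open>a\<close> is not above
      \<open>e\<close>. Hence \<open>d\<close> precedes \<open>a\<close>, which is at most
      \<open>e\<close>, and \<open>e\<close> precedes \<open>b\<close>; so \<open>d\<close> lies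
      below the fixed \<open>b\<close>.\<close>
    have "ternary ` \<Y> - U \<subseteq> (ternary \<circ> t) ` (A \<times> underS \<dd> b)"
    proof
      fix r assume r: "r \<in> ternary ` \<Y> - U"
      then obtain a d where ad: "a \<in> A" "d \<in> underS \<dd> a" "r = ternary (t (a, d))"
        using U(2) by (auto simp: \<Y>_def \<T>_def)
      have "e \<notin> underS \<dd> a" using in_U[OF ad(1,2)] r ad(3) by auto
      moreover have "(a, e) \<in> \<dd> \<or> (e, a) \<in> \<dd>" "(e, e) \<in> \<dd>"
        using wo_rel.TOTALS[OF wo] e(1) ad(1) A(1) field by auto
      ultimately have "(a, e) \<in> \<dd>" unfolding underS_def by auto
      with ad(2) b(2) have "(d, e) \<in> \<dd>" "(e, b) \<in> \<dd>" "e \<noteq> b"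
        using transD[OF wo_rel.TRANS[OF wo]] unfolding underS_def by blast+
      then have "d \<in> underS \<dd> b"
        using transD[OF wo_rel.TRANS[OF wo]] antisymD[OF wo_rel.ANTISYM[OF wo]]
        unfolding underS_def by blast
      with ad show "r \<in> (ternary \<circ> t) ` (A \<times> underS \<dd> b)" by auto
    qed
    then have "|ternary ` \<Y> - U| \<le>o |A \<times> underS \<dd> b|" by (rule surj_imp_ordLeq)
    also have "|A \<times> underS \<dd> b| <o \<dd>"
      using card field assms A b(1)
      by (intro card_of_Times_ordLess_Cinfinite[OF dominating_number_Cinfinite] card_of_underS) auto
    finally show ?thesis .
  qed
  then have "concentrated \<dd> (top_of_set (ternary ` \<Y>))"
    using \<open>\<dd> \<le>o |ternary ` \<Y>|\<close> dominating_number_Cinfinite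
    unfolding concentrated_def
    by (intro conjI exI[of _ "ternary ` Collect finite"]) 
      (auto simp: \<Y>_def intro: countable_image countable_Collect_finite)

  \<comment> \<open>Failure of the Menger property\<close>
  moreover have "\<not> Menger (prod_topology (top_of_set (ternary ` \<X>)) (top_of_set (ternary ` \<Y>)))"
  proof
    \<comment> \<open>The first disjunct describes the open complement of the closed set where
      \<open>S\<close> is the even part of \<open>T\<close>. On that set, \<open>P\<close> bounds
      the element with index \<open>n\<close> of the odd part by \<open>k\<close>.\<close>
    define P where "P n k S T \<longleftrightarrow> (\<exists>i. (i \<in> S) \<noteq> (2 * i \<in> T)) \<or> n < card {i. Suc (2 * i) \<in> T \<and> i < k}"
      for n k :: nat and S T :: "nat set"
    define V where "V n k = {(ternary S, ternary T) |S T. S \<in> \<X> \<and> T \<in> \<Y> \<and> P n k S T}" for n k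
    let ?Z = "prod_topology (top_of_set (ternary ` \<X>)) (top_of_set (ternary ` \<Y>))"
    assume "Menger ?Z"
    moreover have "openin ?Z (V n k)" for n k
      unfolding V_def prod_topology_subtopology_eu
    proof (rule openin_ternary_Times)
      fix S T assume "P n k S T"
      then consider i where "(i \<in> S) \<noteq> (2 * i \<in> T)" | "n < card {i. Suc (2 * i) \<in> T \<and> i < k}"
        unfolding P_def by blast
      then show "\<exists>m. \<forall>S' T'. (\<forall>i\<le>m. (i \<in> S') = (i \<in> S) \<and> (i \<in> T') = (i \<in> T)) \<longrightarrow> P n k S' T'"
      proof cases
        case 1
        have "P n k S' T'" if "\<forall>j\<le>2 * i. (j \<in> S') = (j \<in> S) \<and> (j \<in> T') = (j \<in> T)" for S' T'
          unfolding P_def using 1 that[rule_format, of i] that[rule_format, of "2 * i"] by auto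
        then show ?thesis by blast
      next
        case 2
        \<comment> \<open>Agreement up to \<open>2 * k\<close> suffices, since \<open>i < k\<close>
          gives \<open>Suc (2 * i) < 2 * k\<close>.\<close>
        have "P n k S' T'" if "\<forall>j\<le>2 * k. (j \<in> S') = (j \<in> S) \<and> (j \<in> T') = (j \<in> T)" for S' T'
        proof -
          have "{i. Suc (2 * i) \<in> T' \<and> i < k} = {i. Suc (2 * i) \<in> T \<and> i < k}"
            using that by auto
          with 2 show ?thesis by (simp add: P_def)
        qed
        then show ?thesis by blast
      qed
    qed
    moreover have "mono (V n)" for n
    proof (rule monoI)
      fix j k :: nat assume "j \<le> k"
      then have "card {i. Suc (2 * i) \<in> T \<and> i < j} \<le> card {i. Suc (2 * i) \<in> T \<and> i < k}" for T
        by (intro card_mono) auto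
      then have "P n k S T" if "P n j S T" for S T
        using that unfolding P_def by (meson less_le_trans)
      then show "V n j \<subseteq> V n k"
        unfolding V_def by blast
    qed
    moreover have "\<exists>k. p \<in> V n k" if "p \<in> topspace ?Z" for n p
    proof -
      have "p \<in> ternary ` \<X> \<times> ternary ` \<Y>"
        using that by simp
      then obtain S T where p: "p = (ternary S, ternary T)" "S \<in> \<X>" "T \<in> \<Y>"
        by (elim SigmaE imageE) simp
      have "\<exists>k. P n k S T"
      proof (cases "\<exists>i. (i \<in> S) \<noteq> (2 * i \<in> T)")
        case False
        \<comment> \<open>As \<open>S\<close> is infinite, \<open>T\<close> is not one of the finite
          sets, so it is a join with infinite odd part.\<close>
        then have "(\<lambda>i. 2 * i) ` S \<subseteq> T" by auto
        moreover have "infinite S" using p(2) y by (auto simp: \<X>_def)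
        ultimately have "infinite T"
          by (metis finite_imageD finite_subset inj_on_mult zero_neq_numeral)
        then obtain a d where ad: "a \<in> A" "d \<in> underS \<dd> a" "T = t (a, d)"
          using p(3) by (auto simp: \<Y>_def \<T>_def)
        let ?z = "enumerate d ` y a"
        have "n < card {i\<in>?z. i < Suc (enumerate ?z n)}"
          using enumerate_less_iff_card[OF odd_inf[OF ad(1,2)]] by blast
        moreover have "{i. Suc (2 * i) \<in> T \<and> i < k} = {i\<in>?z. i < k}" for k
          by (simp add: ad(3) t_def)
        ultimately have "P n (Suc (enumerate ?z n)) S T"
          unfolding P_def by simp
        then show ?thesis ..
      qed (auto simp: P_def)
      then show ?thesis using p by (auto simp: V_def)
    qed
    ultimately have "\<exists>k. \<forall>p\<in>topspace ?Z. \<exists>\<^sub>\<infinity>n. p \<in> V n (k n)"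
      by (rule Menger_increasing_INFM)
    then obtain k where k: "\<forall>p\<in>topspace ?Z. \<exists>\<^sub>\<infinity>n. p \<in> V n (k n)" ..
    obtain d where d: "d \<in> D" "\<forall>\<^sub>\<infinity>n. k n \<le> enumerate d n" using dom_fun by blast
    obtain a where a: "a \<in> A" "d \<in> underS \<dd> a" using above d by blast
    \<comment> \<open>For this pair the first disjunct of \<open>P\<close> fails, so infinitely
      often \<open>k n\<close> exceeds the element with index \<open>n\<close> of the odd part,
      hence that of \<open>d\<close>. But \<open>d\<close> eventually bounds
      \<open>k\<close>.\<close>
    let ?p = "(ternary (y a), ternary (t (a, d)))"
    have "?p \<in> topspace ?Z" using a by (auto simp: \<X>_def \<Y>_def \<T>_def)
    from frequently_eventually_frequently[OF bspec[OF k this] d(2)]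
    obtain n where n: "?p \<in> V n (k n)" "k n \<le> enumerate d n"
      by (auto dest: frequently_ex)
    then have "P n (k n) (y a) (t (a, d))"
      by (auto simp: V_def inj_eq[OF inj_ternary])
    then have "n < card {i \<in> enumerate d ` y a. i < k n}"
      by (simp add: P_def t_def)
    also have "\<dots> \<le> card {i\<in>d. i < k n}"
      using odd_sub[OF a(2)] by (intro card_mono) auto
    finally have "enumerate d n < k n"
      using enumerate_less_iff_card Dinf d(1) by blast
    with n(2) show False by simp
  qed
  ultimately show ?thesis by blast
qed

end
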